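(* For $n \geq 3$ a positively linearly independent set in $\mathbb{R}^n$ may contain an arbitrary number of vectors. That is, for every integer $n \geq 3$ and every positive integer $m$ there exists a positively linearly independent set $\mathcal{V} \subseteq \mathbb{R}^n$ with $|\mathcal{V}| = m$.
   Context: For a finite set of vectors $\mathcal{V} = \{v^1, v^2, \ldots, v^m\} \subseteq \mathbb{R}^n$ (distinct vectors), the positive span of $\mathcal{V}$ is $\text{p-span}(\mathcal{V}) = \left\{\sum_{i=1}^m \alpha_i v^i : \alpha_i \geq 0 \text{ for all } i = 1, \ldots, m\right\}$. The set $\mathcal{V}$ is positively linearly independent if $v^i \notin \text{p-span}(\mathcal{V} \setminus \{v^i\})$ for all $i = 1, \ldots, m$. By convention any set consisting of exactly one vector (including $\{0\}$) is positively linearly independent, i.e. the positive span of the empty set is taken to be empty. *)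

theory Defs
  imports "HOL-Analysis.Analysis"
begin

text \<open>
  The positive span of the empty set is taken to be empty, not \<open>{0}\<close> (the value the
  empty sum would give), so that every one-element set, including \<open>{0}\<close>, is positively
  linearly independent. The definition is meant for finite \<open>V\<close>.
\<close>

definition p_span :: "'a::real_vector set \<Rightarrow> 'a set" where
  "p_span V = (if V = {} then {} else {(\<Sum>v\<in>V. \<alpha> v *\<^sub>R v) | \<alpha>. \<forall>v\<in>V. 0 \<le> \<alpha> v})"

definition pos_lin_indep :: "'a::real_vector set \<Rightarrow> bool" where
  "pos_lin_indep V \<longleftrightarrow> finite V \<and> (\<forall>v\<in>V. v \<notin> p_span (V - {v}))"

lemma pos_lin_indep_singleton: "pos_lin_indep {v}"
  by (simp add: pos_lin_indep_def p_span_def)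

end

(* Points on the moment curve (1, t, t^2): each lies on a face of their cone, since
   the functional (s^2, -2 s, 1) takes the value (t - s)^2 at parameter t. *)
theory Submission
  imports Defs
begin

text \<open>A cone in three dimensions can have arbitrarily many extreme rays, for instance the cone
  over a convex polygon. Here the vertices lie on a parabola at height 1, and the tangent at a
  vertex gives a functional that vanishes there and is positive at all other vertices. By
  \<open>pos_lin_indep_if_exposed\<close>, such functionals rule out writing a vertex as a
  nonnegative combination of the others.\<close>

lemma pos_lin_indep_if_exposed:
  fixes V :: "'a::real_inner set"
  assumes fin: "finite V"
    and nz: "0 \<notin> V"
    and exposed: "\<And>v. v \<in> V \<Longrightarrow> \<exists>w. w \<bullet> v = 0 \<and> (\<forall>u\<in>V - {v}. w \<bullet> u > 0)"
  shows "pos_lin_indep V"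
  unfolding pos_lin_indep_def
proof (intro conjI ballI notI)
  fix v assume v: "v \<in> V" and "v \<in> p_span (V - {v})"
  then obtain \<alpha> where eq: "v = (\<Sum>u\<in>V - {v}. \<alpha> u *\<^sub>R u)"
    and \<alpha>: "\<forall>u\<in>V - {v}. 0 \<le> \<alpha> u"
    by (auto simp: p_span_def split: if_splits)
  from exposed[OF v] obtain w where w: "w \<bullet> v = 0" and pos: "\<forall>u\<in>V - {v}. w \<bullet> u > 0"
    by blast
  \<comment> \<open>Pairing with \<open>w\<close> turns the representation of \<open>v\<close> into
    a zero sum of nonnegative terms; since each \<open>w \<bullet> u\<close> is positive, all
    coefficients vanish, which forces \<open>v = 0\<close>.\<close>
  have "w \<bullet> v = (\<Sum>u\<in>V - {v}. \<alpha> u * (w \<bullet> u))"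
    by (subst eq) (simp add: inner_sum_right)
  then have "(\<Sum>u\<in>V - {v}. \<alpha> u * (w \<bullet> u)) = 0"
    using w by simp
  moreover have "\<forall>u\<in>V - {v}. 0 \<le> \<alpha> u * (w \<bullet> u)"
    using \<alpha> pos by (simp add: less_imp_le)
  ultimately have "\<forall>u\<in>V - {v}. \<alpha> u * (w \<bullet> u) = 0"
    using sum_nonneg_eq_0_iff[of "V - {v}" "\<lambda>u. \<alpha> u * (w \<bullet> u)"] fin by blast
  then have "\<forall>u\<in>V - {v}. \<alpha> u = 0"
    using pos by (metis less_irrefl mult_eq_0_iff)
  then have "v = 0"
    by (subst eq) simp
  then show False
    using v nz by simp
qed (fact fin)

theorem theorem1:
  fixes m :: nat
  assumes "CARD('n::finite) \<ge> 3" and "m \<ge> 1"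
  shows "\<exists>V :: (real ^ 'n) set. pos_lin_indep V \<and> card V = m"
proof -
  obtain T :: "'n set" where "card T = 3"
    using obtain_subset_with_card_n[OF assms(1)] by metis
  then obtain a b c :: 'n where abc: "a \<noteq> b" "b \<noteq> c" "a \<noteq> c"
    by (auto simp: card_3_iff)
  define p :: "nat \<Rightarrow> real ^ 'n" where
    "p t = axis a 1 + real t *\<^sub>R axis b 1 + (real t)\<^sup>2 *\<^sub>R axis c 1" for t
  \<comment> \<open>The coefficients of (t - s)^2 expanded in powers of t: the tangent to the
    parabola at parameter s.\<close>
  define w :: "nat \<Rightarrow> real ^ 'n" where
    "w s = (real s)\<^sup>2 *\<^sub>R axis a 1 - (2 * real s) *\<^sub>R axis b 1 + axis c 1" for s
  have wp: "w s \<bullet> p t = (real t - real s)\<^sup>2" for s t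
    using abc
    by (simp add: w_def p_def inner_add_left inner_add_right inner_diff_left inner_axis_axis
        power2_eq_square algebra_simps)
  \<comment> \<open>The constant coordinate keeps the points away from 0; coordinate
    \<open>b\<close> below recovers the parameter, so m parameters give m points.\<close>
  have "p t $ a = 1" for t
    using abc by (simp add: p_def axis_def)
  then have nz: "p t \<noteq> 0" for t
    by (metis zero_index zero_neq_one)
  have "p t $ b = real t" for t
    using abc by (simp add: p_def axis_def)
  then have "inj p"
    by (metis injI of_nat_eq_iff)
  then have "card (p ` {..<m}) = m"
    by (simp add: card_image inj_on_subset)
  moreover have "pos_lin_indep (p ` {..<m})"
  proof (rule pos_lin_indep_if_exposed)
    fix v assume "v \<in> p ` {..<m}"
    then obtain s where s: "v = p s"
      by blast
    have "w s \<bullet> u > 0" if u: "u \<in> p ` {..<m} - {v}" for u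
    proof -
      obtain t where t: "u = p t" "t \<noteq> s"
        using u s by blast
      then show ?thesis
        by (simp add: wp)
    qed
    then show "\<exists>w. w \<bullet> v = 0 \<and> (\<forall>u\<in>p ` {..<m} - {v}. w \<bullet> u > 0)"
      using s by (intro exI[of _ "w s"]) (simp add: wp)
  next
    show "0 \<notin> p ` {..<m}"
      using nz by (metis imageE)
  qed simp
  ultimately show ?thesis
    by blast
qed

end
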